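(* The matrix $\frac13(J_4-I_4)$ is the unique matrix for which the permanent of the matrices from $Z_4$ attains its minimal value.
   Context: $I_4$ is the $4\times4$ identity matrix and $J_4$ is the $4\times4$ matrix all of whose entries equal $1$. A real square matrix is doubly stochastic if all its entries are non-negative and the entries in every row and in every column sum to $1$. $Z_4$ denotes the set of all $4\times4$ symmetric doubly stochastic matrices with vanishing diagonal. The permanent of an $m\times m$ matrix $A=[a_{ij}]$ is $\operatorname{per}A:=\sum_{\sigma\in S_m}a_{1\sigma(1)}a_{2\sigma(2)}\cdots a_{m\sigma(m)}$, where $S_m$ is the symmetric group on $m$ letters. *)

theory Defs
  imports "HOL-Analysis.Analysis"
begin

definition per :: "'a::comm_ring_1 ^ 'n::finite ^ 'n \<Rightarrow> 'a" where
  "per A = (\<Sum>p | p permutes (UNIV :: 'n set). \<Prod>i\<in>UNIV. A $ i $ p i)"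

definition doubly_stochastic :: "real ^ 'n::finite ^ 'n \<Rightarrow> bool" where
  "doubly_stochastic A \<longleftrightarrow>
     (\<forall>i j. 0 \<le> A $ i $ j) \<and>
     (\<forall>i. (\<Sum>j\<in>UNIV. A $ i $ j) = 1) \<and>
     (\<forall>j. (\<Sum>i\<in>UNIV. A $ i $ j) = 1)"

definition Z4 :: "(real ^ 4 ^ 4) set" where
  "Z4 = {A. transpose A = A \<and> doubly_stochastic A \<and> (\<forall>i. A $ i $ i = 0)}"

definition J4 :: "real ^ 4 ^ 4" where
  "J4 = (\<chi> i j. 1)"

abbreviation I4 :: "real ^ 4 ^ 4" where
  "I4 \<equiv> mat 1"

end

theory Submission
  imports Defs
begin

text \<open>
  The row sums of a symmetric doubly stochastic matrix with zero diagonal force entries whose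
  positions are disjoint pairs of indices to coincide, so the matrix is determined by its first row
  \<open>(0, a, b, c)\<close>. The nine derangements then give the permanent \<open>(a\<^sup>2 + b\<^sup>2 + c\<^sup>2)\<^sup>2\<close>, and on the
  plane \<open>a + b + c = 1\<close> the sum of squares has its unique minimum at \<open>a = b = c = 1/3\<close>.
\<close>

lemma per_4:
  "per (A :: 'a::comm_ring_1 ^ 4 ^ 4) = (\<Sum>p | p permutes {1,2,3,4}. A $ 1 $ p 1 * A $ 2 $ p 2 * A $ 3 $ p 3 * A $ 4 $ p 4)"
  unfolding per_def UNIV_4 by (simp add: mult.assoc)

text \<open>Only derangements survive: the three double transpositions, then the six 4-cycles, each
  followed by its inverse.\<close>

lemma per_4_zero_diagonal:
  fixes A :: "'a::comm_ring_1 ^ 4 ^ 4"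
  assumes "\<And>i. A $ i $ i = 0"
  shows "per A =
    A$1$2 * A$2$1 * A$3$4 * A$4$3 + A$1$3 * A$3$1 * A$2$4 * A$4$2 + A$1$4 * A$4$1 * A$2$3 * A$3$2
    + A$1$2 * A$2$3 * A$3$4 * A$4$1 + A$1$4 * A$4$3 * A$3$2 * A$2$1
    + A$1$2 * A$2$4 * A$4$3 * A$3$1 + A$1$3 * A$3$4 * A$4$2 * A$2$1
    + A$1$3 * A$3$2 * A$2$4 * A$4$1 + A$1$4 * A$4$2 * A$2$3 * A$3$1"
proof -
  have f: "finite {2::4, 3, 4}" "1 \<notin> {2::4, 3, 4}" "finite {3::4, 4}" "2 \<notin> {3::4, 4}"
    "finite {4::4}" "3 \<notin> {4::4}" by auto
  show ?thesis
    unfolding per_4 sum_over_permutations_insert[OF f(1,2)]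
      sum_over_permutations_insert[OF f(3,4)] sum_over_permutations_insert[OF f(5,6)] permutes_sing
    by (simp add: assms algebra_simps)
qed

lemma vector_4 [simp]:
  "(vector [w,x,y,z] :: ('a::zero) ^ 4) $ 1 = w"
  "(vector [w,x,y,z] :: ('a::zero) ^ 4) $ 2 = x"
  "(vector [w,x,y,z] :: ('a::zero) ^ 4) $ 3 = y"
  "(vector [w,x,y,z] :: ('a::zero) ^ 4) $ 4 = z"
  unfolding vector_def by simp_all

text \<open>The combination, with weights \<open>a\<close>, \<open>b\<close>, \<open>c\<close>, of
  the permutation matrices of the three double transpositions.\<close>

definition zmat :: "real \<Rightarrow> real \<Rightarrow> real \<Rightarrow> real ^ 4 ^ 4" where
  "zmat a b c = vector [vector [0,a,b,c], vector [a,0,c,b], vector [b,c,0,a], vector [c,b,a,0]]"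

lemma zmat_nth:
  "zmat a b c $ 1 = vector [0,a,b,c]" "zmat a b c $ 2 = vector [a,0,c,b]"
  "zmat a b c $ 3 = vector [b,c,0,a]" "zmat a b c $ 4 = vector [c,b,a,0]"
  by (simp_all add: zmat_def)

text \<open>Double transpositions give the fourth powers; a 4-cycle and its inverse give the same
  product of two squares, hence the doubled mixed terms.\<close>

lemma per_zmat: "per (zmat a b c) = (a\<^sup>2 + b\<^sup>2 + c\<^sup>2)\<^sup>2"
proof -
  have "zmat a b c $ i $ i = 0" for i
    using exhaust_4[of i] by (auto simp: zmat_nth)
  then show ?thesis
    by (simp add: per_4_zero_diagonal zmat_nth power2_eq_square algebra_simps)
qed

lemma Z4_eq_zmat:
  assumes "A \<in> Z4"
  obtains a b c where "A = zmat a b c" "a + b + c = 1"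
proof -
  have sym: "A $ i $ j = A $ j $ i" and diag: "A $ i $ i = 0" 
    and row: "A$i$1 + A$i$2 + A$i$3 + A$i$4 = 1" for i j
    using assms by (auto simp: Z4_def doubly_stochastic_def transpose_def vec_eq_iff sum_4)
  note r = row[of 1] row[of 2] row[of 3] row[of 4] sym[of 2 1] sym[of 3 1] sym[of 4 1]
    sym[of 3 2] sym[of 4 2] sym[of 4 3]
  \<comment> \<open>For the first equation, rows 1 and 2 minus rows 3 and 4 leave
    \<open>2 * A$1$2 - 2 * A$3$4 = 0\<close> by symmetry; the others are analogous.\<close>
  have "A $ 3 $ 4 = A $ 1 $ 2" "A $ 2 $ 4 = A $ 1 $ 3" "A $ 2 $ 3 = A $ 1 $ 4"
    using r by (simp_all add: diag)
  then have "A = zmat (A$1$2) (A$1$3) (A$1$4)"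
    by (simp add: vec_eq_iff forall_4 zmat_nth diag r(5-))
  moreover have "A$1$2 + A$1$3 + A$1$4 = 1" using row[of 1] by (simp add: diag)
  ultimately show thesis by (rule that)
qed

lemma zmat_in_Z4:
  assumes "0 \<le> a" "0 \<le> b" "0 \<le> c" "a + b + c = 1"
  shows "zmat a b c \<in> Z4"
  using assms
  by (simp add: Z4_def doubly_stochastic_def transpose_def vec_eq_iff forall_4 sum_4 zmat_nth)

lemma J4_minus_I4: "(1/3) *\<^sub>R (J4 - I4) = zmat (1/3) (1/3) (1/3)"
  by (simp add: vec_eq_iff forall_4 zmat_nth J4_def mat_def)

text \<open>The deviations from the mean \<open>1/3\<close> sum to zero, so the linear terms
  cancel.\<close>

lemma sum_squares_sum_one:
  fixes a b c :: real
  assumes "a + b + c = 1"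
  shows "a\<^sup>2 + b\<^sup>2 + c\<^sup>2 = 1/3 + ((a - 1/3)\<^sup>2 + (b - 1/3)\<^sup>2 + (c - 1/3)\<^sup>2)"
  using assms by algebra

lemma per_Z4:
  assumes "A \<in> Z4"
  shows "1/9 \<le> per A" and "per A = 1/9 \<Longrightarrow> A = (1/3) *\<^sub>R (J4 - I4)"
proof -
  obtain a b c where A: "A = zmat a b c" and s: "a + b + c = 1"
    using assms by (rule Z4_eq_zmat)
  define d where "d = (a - 1/3)\<^sup>2 + (b - 1/3)\<^sup>2 + (c - 1/3)\<^sup>2"
  have d: "0 \<le> d" by (simp add: d_def)
  have "per A = (1/3 + d)\<^sup>2"
    by (simp add: A per_zmat sum_squares_sum_one[OF s] d_def)
  \<comment> \<open>Since \<open>2/3 + d\<close> is positive, this form yields both the bound and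
    \<open>d = 0\<close> in the equality case.\<close>
  then have per: "per A = 1/9 + d * (2/3 + d)" by algebra
  show "1/9 \<le> per A" using d by (simp add: per)
  assume "per A = 1/9"
  then have "d = 0" using d by (simp add: per)
  then have "a = 1/3 \<and> b = 1/3 \<and> c = 1/3"
    unfolding d_def by (simp add: add_nonneg_eq_0_iff)
  then show "A = (1/3) *\<^sub>R (J4 - I4)" by (metis A J4_minus_I4)
qed

theorem theorem6p11:
  shows "{A. is_arg_min per (\<lambda>B. B \<in> Z4) A} = {(1/3) *\<^sub>R (J4 - I4)}"
proof -
  let ?M = "(1/3) *\<^sub>R (J4 - I4)"
  have M: "?M \<in> Z4" by (simp add: J4_minus_I4 zmat_in_Z4)
  have pM: "per ?M = 1/9" by (simp add: J4_minus_I4 per_zmat power2_eq_square)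
  \<comment> \<open>Comparing a minimizer with \<open>?M\<close> bounds its permanent above by
    \<open>1/9\<close>, so the equality case applies.\<close>
  have "is_arg_min per (\<lambda>B. B \<in> Z4) A \<longleftrightarrow> A = ?M" for A
    unfolding is_arg_min_linorder using per_Z4 M pM by (metis order_antisym)
  then show ?thesis by blast
qed

end
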